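(* Let $n\ge 2$, let $w\in\mathcal T_n$ be a Coxeter element, and consider the action of $w$ on $\mathcal I_n$. (1) The statistic $\chi_j-\chi_{n+1-j}$ is $0$-mesic for every $1\le j\le n$. (2) The statistics $2\chi_1+\chi_2$ and $\chi_{n-1}+2\chi_n$ are both $1$-mesic.
   Context: $[n]=\{1,\dots,n\}$. $\mathcal I_n$ is the set of independent sets of the path graph on $[n]$, i.e. subsets $S\subseteq[n]$ containing no two consecutive integers. For $i\in[n]$ the toggle $\tau_i:\mathcal I_n\to\mathcal I_n$ is defined by: $\tau_i(S)=S\setminus\{i\}$ if $i\in S$; $\tau_i(S)=S\cup\{i\}$ if $i\notin S$ and $S\cup\{i\}\in\mathcal I_n$; and $\tau_i(S)=S$ otherwise. The toggle group $\mathcal T_n$ is the subgroup of the symmetric group on the set $\mathcal I_n$ generated by $\tau_1,\dots,\tau_n$. A Coxeter element of $\mathcal T_n$ is a product of $\tau_1,\dots,\tau_n$, each used exactly once, in some order. $\chi_j(S)=1$ if $j\in S$ and $0$ otherwise. A function $f$ on $\mathcal I_n$ with values in a field of characteristic $0$ is $c$-mesic under the action of $w$ if $\frac1{\#\mathcal O}\sum_{S\in\mathcal O}f(S)=c$ for every $w$-orbit $\mathcal O$. *)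

theory Defs
  imports "HOL-Algebra.Group_Action" "HOL-Algebra.Generated_Groups"
begin

definition indep_sets :: "nat \<Rightarrow> nat set set" where
  "indep_sets n = {S. S \<subseteq> {1..n} \<and> (\<forall>i. \<not> (i \<in> S \<and> Suc i \<in> S))}"

text \<open>The bijections in \<^const>\<open>Bij\<close> are required to be extensional, so toggles are
  restricted to \<^const>\<open>indep_sets\<close>.\<close>

definition toggle :: "nat \<Rightarrow> nat \<Rightarrow> nat set \<Rightarrow> nat set" where
  "toggle n i = (\<lambda>S\<in>indep_sets n.
     if i \<in> S then S - {i}
     else if S \<union> {i} \<in> indep_sets n then S \<union> {i}
     else S)"

definition toggle_group :: "nat \<Rightarrow> (nat set \<Rightarrow> nat set) monoid" where
  "toggle_group n =
     (BijGroup (indep_sets n))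
       \<lparr>carrier := generate (BijGroup (indep_sets n)) (toggle n ` {1..n})\<rparr>"

definition coxeter_elements :: "nat \<Rightarrow> (nat set \<Rightarrow> nat set) set" where
  "coxeter_elements n =
     {foldr (\<otimes>\<^bsub>toggle_group n\<^esub>) (map (toggle n) is) \<one>\<^bsub>toggle_group n\<^esub> | is.
        distinct is \<and> set is = {1..n}}"

text \<open>The orbits of a permutation \<open>w\<close> of \<open>X\<close> are those of the cyclic group
  generated by \<open>w\<close> in the symmetric group on \<open>X\<close>, acting by evaluation.\<close>

definition orbits_of :: "'a set \<Rightarrow> ('a \<Rightarrow> 'a) \<Rightarrow> 'a set set" where
  "orbits_of X w =
     orbits ((BijGroup X)\<lparr>carrier := generate (BijGroup X) {w}\<rparr>) X (\<lambda>g. g)"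

definition mesic ::
  "'a set \<Rightarrow> ('a \<Rightarrow> 'a) \<Rightarrow> ('a \<Rightarrow> 'k::field_char_0) \<Rightarrow> 'k \<Rightarrow> bool" where
  "mesic X w f c \<longleftrightarrow>
     (\<forall>Orb\<in>orbits_of X w. 1 / of_nat (card Orb) * (\<Sum>S\<in>Orb. f S) = c)"

definition chi :: "nat \<Rightarrow> nat set \<Rightarrow> 'k::field_char_0" where
  "chi j S = (if j \<in> S then 1 else 0)"

lemma toggle_closed: "S \<in> indep_sets n \<Longrightarrow> toggle n i S \<in> indep_sets n"
  by (auto simp: toggle_def indep_sets_def)

lemma toggle_toggle:
  assumes "S \<in> indep_sets n"
  shows "toggle n i (toggle n i S) = S"
proof -
  have "S - {i} \<in> indep_sets n"
    using assms by (auto simp: indep_sets_def)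
  then show ?thesis
    using assms by (simp add: toggle_def insert_absorb)
qed

lemma toggle_in_Bij: "toggle n i \<in> Bij (indep_sets n)"
proof -
  have "bij_betw (toggle n i) (indep_sets n) (indep_sets n)"
    by (rule bij_betw_byWitness[where f' = "toggle n i"])
       (auto simp: toggle_toggle toggle_closed)
  then show ?thesis
    by (simp add: Bij_def toggle_def)
qed

lemma group_toggle_group: "group (toggle_group n)"
  unfolding toggle_group_def
  by (intro group.subgroup_imp_group group.generate_is_subgroup group_BijGroup)
     (auto simp: BijGroup_def toggle_in_Bij)

lemma coxeter_elements_subset: "coxeter_elements n \<subseteq> carrier (toggle_group n)"
proof
  fix w assume "w \<in> coxeter_elements n"
  then obtain xs where w: "w = foldr (\<otimes>\<^bsub>toggle_group n\<^esub>) (map (toggle n) xs) \<one>\<^bsub>toggle_group n\<^esub>"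
    and xs: "set xs = {1..n}"
    unfolding coxeter_elements_def by blast
  interpret group "toggle_group n" by (rule group_toggle_group)
  have gen: "toggle n i \<in> carrier (toggle_group n)" if "i \<in> {1..n}" for i
    using that by (auto simp: toggle_group_def intro: generate.incl)
  have "foldr (\<otimes>\<^bsub>toggle_group n\<^esub>) (map (toggle n) ys) \<one>\<^bsub>toggle_group n\<^esub>
      \<in> carrier (toggle_group n)" if "set ys \<subseteq> {1..n}" for ys
    using that by (induction ys) (auto intro!: m_closed gen)
  with w xs show "w \<in> carrier (toggle_group n)" by simp
qed

lemma group_action_orbits_of:
  assumes "w \<in> Bij X"
  shows "group_action ((BijGroup X)\<lparr>carrier := generate (BijGroup X) {w}\<rparr>) X (\<lambda>g. g)"
proof -
  interpret group "BijGroup X" by (rule group_BijGroup)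
  have sub: "subgroup (generate (BijGroup X) {w}) (BijGroup X)"
    using assms by (intro generate_is_subgroup) (simp add: BijGroup_def)
  then show ?thesis
    unfolding group_action_def group_hom_def group_hom_axioms_def
    by (auto simp: hom_def subgroup_imp_group group_BijGroup dest: subgroup.mem_carrier)
qed

end

theory Submission
  imports Defs
begin

text \<open>Record an orbit as a board with one column per vertex, the rows being the successive
  states. Each time vertex \<open>i\<close> is toggled it becomes occupied iff it and both neighbours were
  vacant, and shifting the columns against each other turns the board of an arbitrary Coxeter
  element into that of the left-to-right one without changing column sums. Part (2) is this rule
  read at the two ends. For part (1), the occupied cells split into snakes from column
  \<open>1\<close> to column \<open>n\<close>, a cell \<open>(i, t)\<close> being followed by exactly one of
  \<open>(i + 1, t + 1)\<close> and \<open>(i + 2, t)\<close>. Moving from \<open>(i, t)\<close> to whichever of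
  \<open>(i - 1, t + 2)\<close>, \<open>(i - 2, t + 2)\<close> is occupied translates each snake rigidly along the next
  one. Hence this move matches the pairs of cells on a common snake at column distance \<open>d\<close>
  that do not start in column \<open>1\<close> with those that do not end in column \<open>n\<close>. So
  equally many such pairs start in column \<open>1\<close> as end in column \<open>n\<close>, which says that
  columns \<open>1 + d\<close> and \<open>n - d\<close> have equal sums.\<close>

text \<open>A row is named by the orbit element \<open>x\<close> instead of a time, so that \<open>T\<close> advances
  time and the board is finite and cyclic.\<close>

locale toggle_board =
  fixes n :: nat and X :: "'a set" and T :: "'a \<Rightarrow> 'a" and y :: "nat \<Rightarrow> 'a \<Rightarrow> bool"
  assumes fin: "finite X"
    and bij: "bij_betw T X X"
    and range: "x \<in> X \<Longrightarrow> y i x \<Longrightarrow> 1 \<le> i \<and> i \<le> n"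
    and rule: "x \<in> X \<Longrightarrow> 1 \<le> i \<Longrightarrow> i \<le> n \<Longrightarrow>
      y i (T x) \<longleftrightarrow> \<not> y i x \<and> \<not> y (i - 1) (T x) \<and> \<not> y (i + 1) x"
begin

section \<open>Local exclusion and covering on the board\<close>

lemma T_closed: "x \<in> X \<Longrightarrow> T x \<in> X"
  using bij by (auto simp: bij_betw_def)

lemma T_inj: "x \<in> X \<Longrightarrow> x' \<in> X \<Longrightarrow> T x = T x' \<longleftrightarrow> x = x'"
  using bij by (auto simp: bij_betw_def inj_on_def)

lemma T_surj: "x \<in> X \<Longrightarrow> \<exists>x'\<in>X. x = T x'"
  using bij by (auto simp: bij_betw_def)

text \<open>The rule for column i + 1 forbids an occupied left neighbour in the same row, but it
  speaks only of rows \<open>T x\<close>. Surjectivity of \<open>T\<close> gives every row this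
  form.\<close>

lemma not_next: "x \<in> X \<Longrightarrow> y i x \<Longrightarrow> \<not> y (Suc i) x"
  using T_surj[of x] rule[of _ "Suc i"] range[of x "Suc i"] by auto

lemma not_above: "x \<in> X \<Longrightarrow> y i x \<Longrightarrow> \<not> y i (T x)"
  using rule[of x i] range[of x i] by auto

lemma not_diag: "x \<in> X \<Longrightarrow> y (Suc i) x \<Longrightarrow> \<not> y i (T x)"
  using rule[of x i] range[of "T x" i] T_closed by auto

lemma covered:
  "x \<in> X \<Longrightarrow> i < n \<Longrightarrow>
    y (Suc i) (T x) \<or> y (Suc i) x \<or> y i (T x) \<or> y (Suc (Suc i)) x"
  using rule[of x "Suc i"] by auto

section \<open>Snakes, hops and how they commute\<close>

definition cells :: "(nat \<times> 'a) set" where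
  "cells = {(i, x). x \<in> X \<and> y i x}"

text \<open>A relation, because cells in column n have no successor and because backward arguments
  can then use the converse.\<close>

definition snake :: "((nat \<times> 'a) \<times> nat \<times> 'a) set" where
  "snake = {((i, x), (Suc i, T x)) | i x. x \<in> X \<and> y i x \<and> y (Suc i) (T x)} \<union>
    {((i, x), (Suc (Suc i), x)) | i x. x \<in> X \<and> y i x \<and> y (Suc (Suc i)) x}"

definition hop :: "((nat \<times> 'a) \<times> nat \<times> 'a) set" where
  "hop = {((Suc i, x), (i, T (T x))) | i x. x \<in> X \<and> y (Suc i) x \<and> y i (T (T x))} \<union>
    {((Suc (Suc i), x), (i, T (T x))) | i x. x \<in> X \<and> y (Suc (Suc i)) x \<and> y i (T (T x))}"

lemma snake_intros:
  "x \<in> X \<Longrightarrow> y i x \<Longrightarrow> y (Suc i) (T x) \<Longrightarrow> ((i, x), (Suc i, T x)) \<in> snake"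
  "x \<in> X \<Longrightarrow> y i x \<Longrightarrow> y (Suc (Suc i)) x \<Longrightarrow> ((i, x), (Suc (Suc i), x)) \<in> snake"
  by (auto simp: snake_def)

lemma snake_cases:
  assumes "(u, v) \<in> snake"
  obtains (1) x i where "u = (i, x)" "v = (Suc i, T x)" "x \<in> X" "y i x" "y (Suc i) (T x)"
    | (2) x i where "u = (i, x)" "v = (Suc (Suc i), x)" "x \<in> X" "y i x" "y (Suc (Suc i)) x"
  using assms unfolding snake_def by blast

lemma hop_intros:
  "x \<in> X \<Longrightarrow> y (Suc i) x \<Longrightarrow> y i (T (T x)) \<Longrightarrow> ((Suc i, x), (i, T (T x))) \<in> hop"
  "x \<in> X \<Longrightarrow> y (Suc (Suc i)) x \<Longrightarrow> y i (T (T x)) \<Longrightarrow> ((Suc (Suc i), x), (i, T (T x))) \<in> hop"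
  by (auto simp: hop_def)

lemma hop_cases:
  assumes "(u, v) \<in> hop"
  obtains (1) x i where "u = (Suc i, x)" "v = (i, T (T x))" "x \<in> X" "y (Suc i) x" "y i (T (T x))"
    | (2) x i where "u = (Suc (Suc i), x)" "v = (i, T (T x))" "x \<in> X"
        "y (Suc (Suc i)) x" "y i (T (T x))"
  using assms unfolding hop_def by blast

lemma finite_cells: "finite cells"
proof (rule finite_subset)
  show "cells \<subseteq> {1..n} \<times> X" using range by (auto simp: cells_def)
qed (use fin in auto)

lemma cells_col: "u \<in> cells \<Longrightarrow> 1 \<le> fst u \<and> fst u \<le> n"
  using range by (auto simp: cells_def)

lemma snake_cells: "(u, v) \<in> snake \<Longrightarrow> u \<in> cells \<and> v \<in> cells \<and> fst u < fst v"
  by (erule snake_cases) (auto simp: cells_def T_closed)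

lemma hop_cells: "(u, v) \<in> hop \<Longrightarrow> u \<in> cells \<and> v \<in> cells \<and> fst v < fst u"
  by (erule hop_cases) (auto simp: cells_def T_closed)

text \<open>Here and in the next three lemmas, two of the four cells in a suitable instance of
  \<open>covered\<close> clash with the given occupied cell. The remaining two are the possible
  neighbours along a snake or a hop.\<close>

lemma snake_step:
  "x \<in> X \<Longrightarrow> y i x \<Longrightarrow> i < n \<Longrightarrow> y (Suc i) (T x) \<or> y (Suc (Suc i)) x"
  using covered[of x i] not_next[of x i] not_above[of x i] by auto

lemma snake_back:
  "x \<in> X \<Longrightarrow> y (Suc (Suc i)) (T x) \<Longrightarrow> y (Suc i) x \<or> y i (T x)"
  using covered[of x i] not_next[of "T x" "Suc i"] not_above[of x "Suc (Suc i)"]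
    range[of "T x" "Suc (Suc i)"] T_closed by auto

lemma hop_step:
  "x \<in> X \<Longrightarrow> y (Suc (Suc i)) x \<Longrightarrow> y (Suc i) (T (T x)) \<or> y i (T (T x))"
  using covered[of "T x" i] not_diag[of x "Suc i"] not_above[of x "Suc (Suc i)"]
    range[of x "Suc (Suc i)"] T_closed by auto

lemma hop_back:
  "x \<in> X \<Longrightarrow> y i (T (T x)) \<Longrightarrow> i < n \<Longrightarrow> y (Suc i) x \<or> y (Suc (Suc i)) x"
  using covered[of x i] not_diag[of "T x" i] not_above[of "T x" i] T_closed by auto

lemma snake_total:
  assumes "u \<in> cells" "fst u < n"
  shows "\<exists>v. (u, v) \<in> snake"
proof -
  obtain i x where u: "u = (i, x)" by (cases u)
  with assms have x: "x \<in> X" "y i x" "i < n" by (auto simp: cells_def)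
  from snake_step[OF x] show ?thesis unfolding u
    using snake_intros[OF x(1,2)] by blast
qed

lemma snake_onto:
  assumes "v \<in> cells" "1 < fst v"
  shows "\<exists>u. (u, v) \<in> snake"
proof -
  obtain j z where j: "v = (j, z)" by (cases v)
  \<comment> \<open>The subtraction is exact since \<open>1 < j\<close>. For j = 2 the index i is 0;
    column 0 is empty by \<open>range\<close>, so only the first alternative of
    \<open>snake_back\<close> can occur.\<close>
  define i where "i = j - 2"
  have i: "j = Suc (Suc i)" using assms j by (simp add: i_def)
  obtain x where x: "x \<in> X" "z = T x" using assms j T_surj by (auto simp: cells_def)
  have y: "y (Suc (Suc i)) (T x)" using assms j i x by (auto simp: cells_def)
  from snake_back[OF x(1) y] show ?thesis unfolding j i x(2)
    using snake_intros(1)[OF x(1) _ y] snake_intros(2)[OF T_closed[OF x(1)] _ y] by blast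
qed

lemma hop_total:
  assumes "u \<in> cells" "1 < fst u"
  shows "\<exists>v. (u, v) \<in> hop"
proof -
  obtain j x where j: "u = (j, x)" by (cases u)
  define i where "i = j - 2"
  have i: "j = Suc (Suc i)" using assms j by (simp add: i_def)
  have y: "x \<in> X" "y (Suc (Suc i)) x" using assms j i by (auto simp: cells_def)
  from hop_step[OF y] show ?thesis unfolding j i
    using hop_intros(1)[OF y] hop_intros(2)[OF y] by blast
qed

lemma hop_onto:
  assumes "v \<in> cells" "fst v < n"
  shows "\<exists>u. (u, v) \<in> hop"
proof -
  obtain i z where i: "v = (i, z)" by (cases v)
  with assms have z: "z \<in> X" "y i z" "i < n" by (auto simp: cells_def)
  then obtain x where x: "x \<in> X" "z = T (T x)" using T_surj by metis
  have y: "y i (T (T x))" using x z by simp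
  from hop_back[OF x(1) y z(3)] show ?thesis unfolding i x(2)
    using hop_intros[OF x(1) _ y] by blast
qed

text \<open>The two candidate successors exclude each other by \<open>not_diag\<close>, and so do
  the two candidate predecessors. For \<open>hop\<close> the two candidates lie side by side in one
  row, in either direction, and \<open>not_next\<close> does the same.\<close>

lemma single_valued_snake: "single_valued snake"
proof (rule single_valuedI)
  fix u v v' assume "(u, v) \<in> snake" "(u, v') \<in> snake"
  then show "v = v'"
    using not_diag by (elim snake_cases) auto
qed

lemma single_valued_snake_converse: "single_valued (snake\<inverse>)"
proof (rule single_valuedI, unfold converse_iff)
  fix u u' v assume "(u, v) \<in> snake" "(u', v) \<in> snake"
  then show "u = u'"
    using not_diag by (elim snake_cases) (auto simp: T_inj)
qed

lemma single_valued_hop: "single_valued hop"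
proof (rule single_valuedI)
  fix u v v' assume "(u, v) \<in> hop" "(u, v') \<in> hop"
  then show "v = v'"
    using not_next T_closed by (elim hop_cases) auto
qed

lemma single_valued_hop_converse: "single_valued (hop\<inverse>)"
proof (rule single_valuedI, unfold converse_iff)
  fix u u' v assume "(u, v) \<in> hop" "(u', v) \<in> hop"
  then show "u = u'"
    using not_next by (elim hop_cases) (auto simp: T_inj T_closed)
qed

text \<open>One step of the rigid translation: the hop carries a snake step to a snake step of the
  same type. In each of the four combinations the only alternative position of the new cell is
  blocked by an occupied cell.\<close>

lemma hop_snake_square:
  assumes "(u, v) \<in> snake" "(u, u') \<in> hop"
  shows "\<exists>v'. (v, v') \<in> hop \<and> (u', v') \<in> snake \<and> fst v' + fst u = fst v + fst u'"
  using assms(2)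
proof (cases rule: hop_cases)
  case (1 x i)
  note u = 1
  have T: "T x \<in> X" "T (T x) \<in> X" "T (T (T x)) \<in> X" using u T_closed by auto
  from assms(1) show ?thesis
  proof (cases rule: snake_cases)
    case (1 x' i')
    with u have v: "v = (Suc (Suc i), T x)" "y (Suc (Suc i)) (T x)" by auto
    have "y (Suc i) (T (T (T x)))"
      using hop_step[of "T x" i] not_above[of "T (T x)" i] v u T by auto
    then show ?thesis using u v T hop_intros(1)[of "T x" "Suc i"] snake_intros(1)[of "T (T x)" i] by auto
  next
    case (2 x' i')
    with u have v: "v = (Suc (Suc (Suc i)), x)" "y (Suc (Suc (Suc i))) x" by auto
    have "y (Suc (Suc i)) (T (T x))"
      using hop_step[of x "Suc i"] not_next[of "T (T x)" i] v u T by auto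
    then show ?thesis using u v T hop_intros(1)[of x "Suc (Suc i)"] snake_intros(2)[of "T (T x)" i] by auto
  qed
next
  case (2 x i)
  note u = 2
  have T: "T x \<in> X" "T (T x) \<in> X" "T (T (T x)) \<in> X" using u T_closed by auto
  have i: "Suc (Suc i) \<le> n" using range u by blast
  from assms(1) show ?thesis
  proof (cases rule: snake_cases)
    case (1 x' i')
    with u have v: "v = (Suc (Suc (Suc i)), T x)" "y (Suc (Suc (Suc i))) (T x)" by auto
    have "y (Suc i) (T (T (T x)))"
      using snake_step[of "T (T x)" i] not_diag[of "T x" "Suc (Suc i)"] v u T i by auto
    then show ?thesis using u v T hop_intros(2)[of "T x" "Suc i"] snake_intros(1)[of "T (T x)" i] by auto
  next
    case (2 x' i')
    with u have v: "v = (Suc (Suc (Suc (Suc i))), x)" "y (Suc (Suc (Suc (Suc i)))) x" by auto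
    \<comment> \<open>If this cell were occupied, hopping back from it would reach column i + 2 or i
      + 3 of row \<open>T x\<close>. The first is blocked by u, directly below, and the second by v,
      diagonally.\<close>
    have "\<not> y (Suc i) (T (T (T x)))"
      using hop_back[of "T x" "Suc i"] not_diag[of x "Suc (Suc (Suc i))"] not_above[of x "Suc (Suc i)"]
        v u T i by auto
    then have "y (Suc (Suc i)) (T (T x))"
      using snake_step[of "T (T x)" i] v u T i by auto
    then show ?thesis using u v T hop_intros(2)[of x "Suc (Suc i)"] snake_intros(2)[of "T (T x)" i] by auto
  qed
qed

text \<open>Once u is known to lie before column n it has a successor, and the forward square
  together with uniqueness of the successor of u' gives the claim. The hypothesis on v' is what
  keeps u out of column n.\<close>

lemma hop_snake_square':
  assumes "(u, u') \<in> hop" "(u', v') \<in> snake" "fst v' < n"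
  shows "\<exists>v. (v, v') \<in> hop \<and> (u, v) \<in> snake \<and> fst v' + fst u = fst v + fst u'"
proof -
  have "fst u < n"
  proof (rule ccontr)
    assume "\<not> fst u < n"
    then have fu: "fst u = n" using hop_cells[OF assms(1)] cells_col[of u] by auto
    from assms(1) show False
    proof (cases rule: hop_cases)
      case (1 x i)
      with fu show False using snake_cells[OF assms(2)] assms(3) by auto
    next
      case u: (2 x i)
      then have T: "T x \<in> X" "T (T x) \<in> X" using T_closed by auto
      from assms(2) show False
      proof (cases rule: snake_cases)
        case (1 x' i')
        with u have "y (Suc i) (T (T (T x)))" by auto
        \<comment> \<open>Here i + 2 = n. Hopping back from v' would need a cell of row
          \<open>T x\<close> in column n, directly above u, or in column n + 1, off the
          board.\<close>
        then have "y (Suc (Suc i)) (T x) \<or> y (Suc (Suc (Suc i))) (T x)"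
          using hop_back[of "T x" "Suc i"] T fu u by auto
        then show False using not_above[of x "Suc (Suc i)"] range[of "T x" "Suc (Suc (Suc i))"] u fu T
          by auto
      next
        case (2 x' i')
        with u fu assms(3) show False by auto
      qed
    qed
  qed
  then obtain v where v: "(u, v) \<in> snake" using snake_total hop_cells assms by blast
  from hop_snake_square[OF this assms(1)] v show ?thesis
    using single_valuedD[OF single_valued_snake assms(2)] by blast
qed

section \<open>Counting pairs of cells on a common snake\<close>

definition same_snake :: "nat \<Rightarrow> ((nat \<times> 'a) \<times> nat \<times> 'a) set" where
  "same_snake d = {(p, q). (p, q) \<in> snake\<^sup>* \<and> p \<in> cells \<and> q \<in> cells \<and> fst q = fst p + d}"

lemma snake_rtrancl_col: "(p, q) \<in> snake\<^sup>* \<Longrightarrow> p = q \<or> fst p < fst q"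
  by (induction rule: rtrancl_induct) (auto dest: snake_cells)

lemma hop_snake_rtrancl:
  assumes "(p, q) \<in> snake\<^sup>*" "(p, p') \<in> hop"
  shows "\<exists>q'. (q, q') \<in> hop \<and> (p', q') \<in> snake\<^sup>* \<and> fst q' + fst p = fst q + fst p'"
  using assms(1)
proof (induction rule: rtrancl_induct)
  case base
  then show ?case using assms(2) by (intro exI[of _ p']) simp
next
  case (step q r)
  then obtain q' where q': "(q, q') \<in> hop" "(p', q') \<in> snake\<^sup>*" "fst q' + fst p = fst q + fst p'"
    by blast
  from hop_snake_square[OF step(2) q'(1)] q' show ?case
    by (force intro: rtrancl_into_rtrancl)
qed

text \<open>Columns increase along a snake, so if its last cell lies before column n then every
  earlier one does, and the backward square applies at each step.\<close>

lemma hop_snake_rtrancl':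
  assumes "(p', q') \<in> snake\<^sup>*" "(p, p') \<in> hop" "fst q' < n"
  shows "\<exists>q. (q, q') \<in> hop \<and> (p, q) \<in> snake\<^sup>* \<and> fst q' + fst p = fst q + fst p'"
  using assms(1,3)
proof (induction rule: rtrancl_induct)
  case base
  then show ?case using assms(2) by (intro exI[of _ p]) simp
next
  case (step q' r')
  then have "fst q' < n" using snake_cells by fastforce
  with step obtain q where q: "(q, q') \<in> hop" "(p, q) \<in> snake\<^sup>*" "fst q' + fst p = fst q + fst p'"
    by blast
  from hop_snake_square'[OF q(1) step(2) step(4)] q show ?case
    by (force intro: rtrancl_into_rtrancl)
qed

text \<open>Two cells from which q is reached are comparable along the snake, because predecessors
  are unique. Comparable cells in one column coincide.\<close>

lemma same_snake_unique:
  assumes "(p, q) \<in> snake\<^sup>*" "(p', q) \<in> snake\<^sup>*" "fst p = fst p'"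
  shows "p = p'"
proof -
  have "(q, p) \<in> (snake\<inverse>)\<^sup>*" "(q, p') \<in> (snake\<inverse>)\<^sup>*"
    using assms by (auto simp: rtrancl_converse)
  from single_valued_confluent[OF single_valued_snake_converse this]
  show ?thesis using snake_rtrancl_col[of p p'] snake_rtrancl_col[of p' p] assms(3)
    by (auto simp: rtrancl_converse)
qed

lemma same_snake_unique':
  assumes "(p, q) \<in> snake\<^sup>*" "(p, q') \<in> snake\<^sup>*" "fst q = fst q'"
  shows "q = q'"
  using single_valued_confluent[OF single_valued_snake assms(1,2)]
    snake_rtrancl_col[of q q'] snake_rtrancl_col[of q' q] assms(3) by auto

lemma snake_start: "q \<in> cells \<Longrightarrow> \<exists>p\<in>cells. fst p = 1 \<and> (p, q) \<in> snake\<^sup>*"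
proof (induction "fst q" arbitrary: q rule: less_induct)
  case less
  show ?case
  proof (cases "1 < fst q")
    case True
    then obtain r where "(r, q) \<in> snake" using snake_onto less by blast
    then show ?thesis using less(1)[of r] snake_cells by (meson rtrancl_into_rtrancl)
  next
    case False
    then show ?thesis using less(2) cells_col[of q] by (intro bexI[of _ q]) auto
  qed
qed

lemma snake_end: "p \<in> cells \<Longrightarrow> \<exists>q\<in>cells. fst q = n \<and> (p, q) \<in> snake\<^sup>*"
proof (induction "n - fst p" arbitrary: p rule: less_induct)
  case less
  show ?case
  proof (cases "fst p < n")
    case True
    then obtain r where r: "(p, r) \<in> snake" using snake_total less by blast
    then have "n - fst r < n - fst p" using snake_cells[OF r] cells_col[of r] by auto
    then show ?thesis using less(1)[of r] snake_cells[OF r] r by (meson converse_rtrancl_into_rtrancl)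
  next
    case False
    then show ?thesis using less(2) cells_col[of p] by (intro bexI[of _ p]) auto
  qed
qed

lemma finite_same_snake: "finite (same_snake d)"
  by (rule finite_subset[of _ "cells \<times> cells"]) (auto simp: same_snake_def finite_cells)

text \<open>Hopping both ends of a pair shifts them by the same number of columns, so d, which
  counts columns and not snake steps, is preserved. A first cell can hop iff it is not in column 1;
  a second cell is the target of a hop iff it is not in column n.\<close>

lemma card_same_snake_hop:
  "card {(p, q) \<in> same_snake d. fst p \<noteq> 1} = card {(p, q) \<in> same_snake d. fst q \<noteq> n}"
proof -
  \<comment> \<open>The graph of the matching; both projections are injective because hops are
    unique in either direction.\<close>
  define G where "G = {((p, q), (p', q')). (p, q) \<in> same_snake d \<and> (p', q') \<in> same_snake d \<and>
    (p, p') \<in> hop \<and> (q, q') \<in> hop}"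
  have "inj_on fst G"
    unfolding G_def inj_on_def using single_valuedD[OF single_valued_hop] by fastforce
  moreover have "inj_on snd G"
    unfolding G_def inj_on_def using single_valuedD[OF single_valued_hop_converse] by fastforce
  moreover have "fst ` G = {(p, q) \<in> same_snake d. fst p \<noteq> 1}" (is "_ = ?L")
  proof
    have "fst p \<noteq> 1" if "(p, p') \<in> hop" for p p'
      using hop_cells[OF that] cells_col[of p'] by linarith
    then show "fst ` G \<subseteq> ?L" unfolding G_def by fastforce
    show "?L \<subseteq> fst ` G"
    proof
      fix z assume "z \<in> ?L"
      then obtain p q where z: "z = (p, q)" "(p, q) \<in> same_snake d" "fst p \<noteq> 1" by auto
      then have pq: "p \<in> cells" "(p, q) \<in> snake\<^sup>*" "fst q = fst p + d"
        by (auto simp: same_snake_def)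
      then have "1 < fst p" using cells_col[of p] z by linarith
      then obtain p' where p': "(p, p') \<in> hop" using hop_total pq by blast
      obtain q' where "(q, q') \<in> hop" "(p', q') \<in> snake\<^sup>*" "fst q' + fst p = fst q + fst p'"
        using hop_snake_rtrancl[OF pq(2) p'] by blast
      with z pq p' hop_cells have "((p, q), (p', q')) \<in> G"
        unfolding G_def same_snake_def by simp
      then show "z \<in> fst ` G" using z by (intro image_eqI) simp_all
    qed
  qed
  moreover have "snd ` G = {(p, q) \<in> same_snake d. fst q \<noteq> n}" (is "_ = ?R")
  proof
    have "fst q' \<noteq> n" if "(q, q') \<in> hop" for q q'
      using hop_cells[OF that] cells_col[of q] by linarith
    then show "snd ` G \<subseteq> ?R" unfolding G_def by fastforce
    show "?R \<subseteq> snd ` G"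
    proof
      fix z assume "z \<in> ?R"
      then obtain p' q' where z: "z = (p', q')" "(p', q') \<in> same_snake d" "fst q' \<noteq> n" by auto
      then have pq: "p' \<in> cells" "q' \<in> cells" "(p', q') \<in> snake\<^sup>*" "fst q' = fst p' + d"
        by (auto simp: same_snake_def)
      then have q': "fst q' < n" using cells_col[of q'] z by linarith
      then obtain p where p: "(p, p') \<in> hop" using hop_onto pq by (metis add_lessD1)
      obtain q where "(q, q') \<in> hop" "(p, q) \<in> snake\<^sup>*" "fst q' + fst p = fst q + fst p'"
        using hop_snake_rtrancl'[OF pq(3) p q'] by blast
      with z pq p hop_cells have "((p, q), (p', q')) \<in> G"
        unfolding G_def same_snake_def by simp
      then show "z \<in> snd ` G" using z by (intro image_eqI) simp_all
    qed
  qed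
  ultimately show ?thesis by (metis card_image)
qed

lemma card_column_reflect:
  assumes "1 \<le> j" "j \<le> n"
  shows "card {x \<in> X. y j x} = card {x \<in> X. y (n + 1 - j) x}"
proof -
  \<comment> \<open>With this distance, a pair starting in column 1 is determined by its end in
    column j, and a pair ending in column n by its start in column n + 1 - j.\<close>
  define d where "d = j - 1"
  have col: "card {x \<in> X. y i x} = card {u \<in> cells. fst u = i}" for i
    by (rule bij_betw_same_card[of "Pair i"]) (force simp: bij_betw_def inj_on_def cells_def)
  let ?A = "{(p, q) \<in> same_snake d. fst p = 1}" and ?B = "{(p, q) \<in> same_snake d. fst q = n}"
  have A: "bij_betw snd ?A {u \<in> cells. fst u = j}"
    unfolding bij_betw_def
  proof
    show "inj_on snd ?A"
      unfolding inj_on_def same_snake_def using same_snake_unique by fastforce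
    show "snd ` ?A = {u \<in> cells. fst u = j}"
    proof
      show "snd ` ?A \<subseteq> {u \<in> cells. fst u = j}"
        using assms by (auto simp: same_snake_def d_def)
      show "{u \<in> cells. fst u = j} \<subseteq> snd ` ?A"
      proof
        fix q assume q: "q \<in> {u \<in> cells. fst u = j}"
        then obtain p where "p \<in> cells" "fst p = 1" "(p, q) \<in> snake\<^sup>*" using snake_start by blast
        then have "(p, q) \<in> ?A" using q assms by (auto simp: same_snake_def d_def)
        then show "q \<in> snd ` ?A" by (rule image_eqI[rotated]) simp
      qed
    qed
  qed
  have B: "bij_betw fst ?B {u \<in> cells. fst u = n + 1 - j}"
    unfolding bij_betw_def
  proof
    show "inj_on fst ?B"
      unfolding inj_on_def same_snake_def using same_snake_unique' by fastforce
    show "fst ` ?B = {u \<in> cells. fst u = n + 1 - j}"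
    proof
      show "fst ` ?B \<subseteq> {u \<in> cells. fst u = n + 1 - j}"
        using assms by (auto simp: same_snake_def d_def)
      show "{u \<in> cells. fst u = n + 1 - j} \<subseteq> fst ` ?B"
      proof
        fix p assume p: "p \<in> {u \<in> cells. fst u = n + 1 - j}"
        then obtain q where "q \<in> cells" "fst q = n" "(p, q) \<in> snake\<^sup>*" using snake_end by blast
        then have "(p, q) \<in> ?B" using p assms by (auto simp: same_snake_def d_def)
        then show "p \<in> fst ` ?B" by (rule image_eqI[rotated]) simp
      qed
    qed
  qed
  have diff: "card (same_snake d - Z) = card (same_snake d) - card Z" if "Z \<subseteq> same_snake d" for Z
    using that finite_same_snake by (intro card_Diff_subset) (auto intro: finite_subset)
  \<comment> \<open>The two boundary sets are complements, in the same finite set, of the two sets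
    matched by the hop.\<close>
  have "card ?A = card (same_snake d - {(p, q) \<in> same_snake d. fst p \<noteq> 1})"
    by (rule arg_cong[where f = card]) auto
  also have "\<dots> = card (same_snake d - {(p, q) \<in> same_snake d. fst q \<noteq> n})"
    by (subst (1 2) diff) (auto simp only: card_same_snake_hop)
  also have "\<dots> = card ?B"
    by (rule arg_cong[where f = card]) auto
  finally show ?thesis
    unfolding col bij_betw_same_card[OF A] bij_betw_same_card[OF B] .
qed

section \<open>The two end columns\<close>

lemma sum_of_bool_T:
  "(\<Sum>x\<in>X. of_bool (y i (T x))) = (\<Sum>x\<in>X. of_bool (y i x) :: 'b::semiring_1)"
  using sum.reindex_bij_betw[OF bij, of "\<lambda>x. of_bool (y i x)"] .

lemma sum_first:
  assumes "1 \<le> n"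
  shows "(\<Sum>x\<in>X. 2 * of_bool (y 1 x) + of_bool (y 2 x)) = (of_nat (card X) :: 'b::comm_ring_1)"
proof -
  \<comment> \<open>With column 0 empty, the rule says that exactly one of these three cells is
    occupied. Summing over the orbit turns the \<open>T x\<close> term into a second copy of column
    1.\<close>
  have "of_bool (y 1 (T x)) + of_bool (y 1 x) + of_bool (y 2 x) = (1 :: 'b)" if "x \<in> X" for x
  proof -
    have "y 1 (T x) \<longleftrightarrow> \<not> y 1 x \<and> \<not> y 0 (T x) \<and> \<not> y 2 x"
      using rule[of x 1] that assms by (simp add: numeral_2_eq_2)
    moreover have "\<not> y 0 (T x)"
      using range[OF T_closed[OF that], of 0] by auto
    moreover have "y 1 x \<Longrightarrow> \<not> y 2 x"
      using not_next[OF that, of 1] by (simp add: numeral_2_eq_2)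
    ultimately show ?thesis by (cases "y 1 x"; cases "y 2 x"; simp)
  qed
  then have "(\<Sum>x\<in>X. of_bool (y 1 (T x)) + of_bool (y 1 x) + of_bool (y 2 x)) = (\<Sum>x\<in>X. 1 :: 'b)"
    by (intro sum.cong) auto
  then show ?thesis
    by (simp only: sum.distrib sum_of_bool_T sum_distrib_left[symmetric] mult_2 sum_constant mult_1_right)
qed

lemma sum_last:
  assumes "1 \<le> n"
  shows "(\<Sum>x\<in>X. of_bool (y (n - 1) x) + 2 * of_bool (y n x)) = (of_nat (card X) :: 'b::comm_ring_1)"
proof -
  have "of_bool (y n (T x)) + of_bool (y n x) + of_bool (y (n - 1) (T x)) = (1 :: 'b)" if "x \<in> X" for x
  proof -
    have "y n (T x) \<longleftrightarrow> \<not> y n x \<and> \<not> y (n - 1) (T x) \<and> \<not> y (n + 1) x"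
      using rule[of x n] that assms by simp
    moreover have "\<not> y (n + 1) x"
      using range[OF that, of "n + 1"] by auto
    moreover have "y n x \<Longrightarrow> \<not> y (n - 1) (T x)"
      using not_diag[OF that, of "n - 1"] assms by simp
    ultimately show ?thesis by (cases "y n x"; cases "y (n - 1) (T x)"; simp)
  qed
  then have "(\<Sum>x\<in>X. of_bool (y n (T x)) + of_bool (y n x) + of_bool (y (n - 1) (T x))) = (\<Sum>x\<in>X. 1 :: 'b)"
    by (intro sum.cong) auto
  then show ?thesis
    by (simp only: sum.distrib sum_of_bool_T sum_distrib_left[symmetric] mult_2 sum_constant mult_1_right
        add.commute)
qed

end

section \<open>From Coxeter elements to boards\<close>

lemma toggle_mem:
  assumes "S \<in> indep_sets n" "i \<in> {1..n}"
  shows "i \<in> toggle n i S \<longleftrightarrow> i \<notin> S \<and> i - 1 \<notin> S \<and> Suc i \<notin> S"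
proof -
  have "S \<union> {i} \<in> indep_sets n \<longleftrightarrow> i - 1 \<notin> S \<and> Suc i \<notin> S" if "i \<notin> S"
    using assms that unfolding indep_sets_def by (cases i) auto
  then show ?thesis using assms by (auto simp: toggle_def)
qed

lemma toggle_mem_other: "S \<in> indep_sets n \<Longrightarrow> j \<noteq> i \<Longrightarrow> j \<in> toggle n i S \<longleftrightarrow> j \<in> S"
  by (auto simp: toggle_def)

lemma foldr_toggle_closed: "S \<in> indep_sets n \<Longrightarrow> foldr (toggle n) is S \<in> indep_sets n"
  by (induction "is") (auto simp: toggle_closed)

lemma foldr_toggle_mem_other:
  "S \<in> indep_sets n \<Longrightarrow> j \<notin> set is \<Longrightarrow> j \<in> foldr (toggle n) is S \<longleftrightarrow> j \<in> S"
  by (induction "is") (auto simp: toggle_mem_other foldr_toggle_closed)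

text \<open>Multiplication in \<open>BijGroup\<close> is composition only between members of
  \<open>Bij\<close>, so membership is carried through the induction.\<close>

lemma foldr_mult_toggle:
  "foldr (\<otimes>\<^bsub>toggle_group n\<^esub>) (map (toggle n) is) \<one>\<^bsub>toggle_group n\<^esub> \<in> Bij (indep_sets n) \<and>
   (\<forall>S\<in>indep_sets n.
     foldr (\<otimes>\<^bsub>toggle_group n\<^esub>) (map (toggle n) is) \<one>\<^bsub>toggle_group n\<^esub> S = foldr (toggle n) is S)"
proof (induction "is")
  case Nil
  show ?case using id_Bij[of "indep_sets n"] by (simp add: toggle_group_def BijGroup_def restrict_def)
next
  case (Cons i "is")
  then show ?case
    using toggle_in_Bij[of n i]
    by (simp add: toggle_group_def BijGroup_def compose_Bij) (simp add: compose_def)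
qed

text \<open>When i is toggled, each neighbour shows its new state if it was toggled earlier and its
  old state otherwise. Thus only the relative order of adjacent toggles matters, and b records
  it.\<close>

lemma coxeter_rule:
  assumes "w \<in> coxeter_elements n"
  obtains b :: "nat \<Rightarrow> bool" where "\<And>S i. S \<in> indep_sets n \<Longrightarrow> 1 \<le> i \<Longrightarrow> i \<le> n \<Longrightarrow>
    i \<in> w S \<longleftrightarrow> i \<notin> S \<and> i - 1 \<notin> (if b (i - 1) then w S else S) \<and> Suc i \<notin> (if b i then S else w S)"
proof -
  obtain "is" where d: "distinct is" "set is = {1..n}"
    and w: "w = foldr (\<otimes>\<^bsub>toggle_group n\<^esub>) (map (toggle n) is) \<one>\<^bsub>toggle_group n\<^esub>"
    using assms unfolding coxeter_elements_def by blast
  have wS: "w S = foldr (toggle n) is S" if "S \<in> indep_sets n" for S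
    using foldr_mult_toggle[of n "is"] that w by simp
  have "\<forall>i\<in>{1..n}. \<exists>k<length is. is ! k = i"
    using d(2) by (auto simp: in_set_conv_nth[symmetric])
  then obtain pos where pos: "\<And>i. i \<in> {1..n} \<Longrightarrow> pos i < length is \<and> is ! pos i = i"
    by metis
  show thesis
  proof (rule that[of "\<lambda>i. pos (Suc i) < pos i"])
    fix S i assume S: "S \<in> indep_sets n" and i: "1 \<le> i" "i \<le> n"
    define as bs where "as = take (pos i) is" and "bs = drop (Suc (pos i)) is"
    have split: "is = as @ i # bs"
      using id_take_nth_drop[of "pos i" "is"] pos[of i] i by (simp add: as_def bs_def)
    \<comment> \<open>The state just before i is toggled.\<close>
    define R where "R = foldr (toggle n) bs S"
    have R: "R \<in> indep_sets n" unfolding R_def using S by (rule foldr_toggle_closed)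
    have wR: "w S = foldr (toggle n) as (toggle n i R)"
      using wS[OF S] split by (simp add: R_def)
    have mem: "j \<in> R \<longleftrightarrow> j \<in> (if pos i < pos j then w S else S)" if j: "j \<in> {1..n}" "j \<noteq> i" for j
    proof (cases "pos i < pos j")
      case True
      then have "bs ! (pos j - Suc (pos i)) = j" "pos j - Suc (pos i) < length bs"
        using pos[OF j(1)] by (auto simp: bs_def)
      then have "j \<in> set bs" by (metis nth_mem)
      then have "j \<notin> set as" using d(1) split by auto
      then show ?thesis using True wR R j
        by (simp add: foldr_toggle_mem_other toggle_mem_other toggle_closed)
    next
      case False
      have "pos i \<noteq> pos j" using pos[OF j(1)] pos[of i] i j by auto
      then have "as ! pos j = j" "pos j < length as"
        using False pos[OF j(1)] pos[of i] i by (auto simp: as_def)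
      then have "j \<in> set as" by (metis nth_mem)
      then have "j \<notin> set bs" using d(1) split by auto
      then show ?thesis using False S by (simp add: foldr_toggle_mem_other R_def)
    qed
    have out: "j \<notin> R \<and> j \<notin> S \<and> j \<notin> w S" if "j \<notin> {1..n}" for j
      using that S R toggle_closed[OF R, of i] foldr_toggle_closed[of "toggle n i R" n as] wR
      by (auto simp: indep_sets_def)
    have "i \<notin> set as" "i \<notin> set bs" using d(1) split by auto
    then have "i \<in> w S \<longleftrightarrow> i \<in> toggle n i R" and iR: "i \<in> R \<longleftrightarrow> i \<in> S"
      using wR R S by (simp_all add: foldr_toggle_mem_other toggle_closed R_def)
    then have "i \<in> w S \<longleftrightarrow> i \<notin> S \<and> i - 1 \<notin> R \<and> Suc i \<notin> R"
      using toggle_mem[OF R, of i] i by auto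
    moreover have "i - 1 \<in> R \<longleftrightarrow> i - 1 \<in> (if pos (Suc (i - 1)) < pos (i - 1) then w S else S)"
      using mem[of "i - 1"] out[of "i - 1"] i by (cases "i - 1 \<in> {1..n}") auto
    moreover have "Suc i \<in> R \<longleftrightarrow> Suc i \<in> (if pos (Suc i) < pos i then S else w S)"
    proof (cases "Suc i \<in> {1..n}")
      case True
      then have "pos i \<noteq> pos (Suc i)" using pos[of i] pos[of "Suc i"] i by auto
      then show ?thesis using mem[OF True] by auto
    qed (use out in auto)
    ultimately show "i \<in> w S \<longleftrightarrow> i \<notin> S \<and>
        i - 1 \<notin> (if pos (Suc (i - 1)) < pos (i - 1) then w S else S) \<and>
        Suc i \<notin> (if pos (Suc i) < pos i then S else w S)"
      by blast
  qed
qed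

lemma orbits_of_bij:
  assumes "w \<in> Bij X" "finite X" "Orb \<in> orbits_of X w"
  shows "Orb \<subseteq> X" "Orb \<noteq> {}" "bij_betw w Orb Orb"
proof -
  let ?G = "generate (BijGroup X) {w}"
  obtain x where x: "x \<in> X" "Orb = {g x | g. g \<in> ?G}"
    using assms(3) by (auto simp: orbits_of_def orbits_def orbit_def)
  have "{w} \<subseteq> carrier (BijGroup X)" using assms(1) by (simp add: BijGroup_def)
  then have "?G \<subseteq> carrier (BijGroup X)"
    by (rule group.generate_incl[OF group_BijGroup])
  then have G: "g \<in> Bij X" if "g \<in> ?G" for g
    using subsetD[OF _ that] by (simp only: BijGroup_def partial_object.simps)
  have "g x \<in> X" if "g \<in> ?G" for g
    using Bij_imp_funcset[OF G[OF that]] x(1) by (rule funcset_mem)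
  then show sub: "Orb \<subseteq> X" using x(2) by blast
  show "Orb \<noteq> {}"
    using x(2) generate.one by blast
  \<comment> \<open>Closure under w suffices: an injective self-map of a finite set is onto.\<close>
  have "w ` Orb \<subseteq> Orb"
  proof
    fix z assume "z \<in> w ` Orb"
    then obtain g where g: "g \<in> ?G" "z = w (g x)" using x(2) by auto
    have "w \<otimes>\<^bsub>BijGroup X\<^esub> g \<in> ?G"
      by (rule generate.eng[OF generate.incl g(1)]) simp
    moreover have "(w \<otimes>\<^bsub>BijGroup X\<^esub> g) x = z"
      using g G[OF g(1)] assms(1) x(1) by (simp add: BijGroup_def compose_def)
    ultimately show "z \<in> Orb" using x(2) by blast
  qed
  moreover have "inj_on w Orb"
    using assms(1) sub by (auto simp: Bij_def bij_betw_def intro: inj_on_subset)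
  ultimately show "bij_betw w Orb Orb"
    using endo_inj_surj[OF finite_subset[OF sub assms(2)]] by (simp add: bij_betw_def)
qed

lemma finite_indep_sets: "finite (indep_sets n)"
  by (rule finite_subset[of _ "Pow {1..n}"]) (auto simp: indep_sets_def)

text \<open>Column i is read at a row displaced by a power of w. This permutes the orbit, so column
  sums do not change.\<close>

lemma coxeter_board:
  assumes "w \<in> coxeter_elements n" "Orb \<in> orbits_of (indep_sets n) w"
  obtains y where "toggle_board n Orb w y"
    and "\<And>i. (\<Sum>S\<in>Orb. chi i S :: 'k::field_char_0) = (\<Sum>S\<in>Orb. of_bool (y i S))"
proof -
  have "w \<in> Bij (indep_sets n)"
    using assms(1) foldr_mult_toggle by (auto simp: coxeter_elements_def)
  note orb = orbits_of_bij[OF this finite_indep_sets assms(2)]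
  obtain b where b: "\<And>S i. S \<in> indep_sets n \<Longrightarrow> 1 \<le> i \<Longrightarrow> i \<le> n \<Longrightarrow>
    i \<in> w S \<longleftrightarrow> i \<notin> S \<and> i - 1 \<notin> (if b (i - 1) then w S else S) \<and> Suc i \<notin> (if b i then S else w S)"
    using coxeter_rule[OF assms(1)] by blast
  \<comment> \<open>\<open>b k\<close> says that \<open>k\<close> is toggled before \<open>k + 1\<close>; every
    adjacent pair in the wrong order shifts the later columns by one row.\<close>
  define s where "s i = card {k. k < i \<and> \<not> b k}" for i :: nat
  have s_Suc: "s (Suc i) = (if b i then s i else Suc (s i))" for i
  proof -
    have "{k. k < Suc i \<and> \<not> b k} = (if b i then {k. k < i \<and> \<not> b k} else insert i {k. k < i \<and> \<not> b k})"
      by (auto simp: less_Suc_eq)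
    then show ?thesis by (simp add: s_def)
  qed
  define y where "y i S \<longleftrightarrow> i \<in> (w ^^ s i) S" for i S
  have bij: "bij_betw (w ^^ k) Orb Orb" for k
    using orb(3) by (rule bij_betw_funpow)
  have closed: "(w ^^ k) S \<in> indep_sets n" if "S \<in> Orb" for k S
    using bij[of k] orb(1) that by (auto simp: bij_betw_def)
  have "toggle_board n Orb w y"
  proof
    show "finite Orb" using orb(1) finite_indep_sets by (rule finite_subset)
    show "bij_betw w Orb Orb" by (rule orb(3))
    show "1 \<le> i \<and> i \<le> n" if "S \<in> Orb" "y i S" for S i
      using closed[OF that(1), of "s i"] that(2) by (auto simp: y_def indep_sets_def)
    show "y i (w S) \<longleftrightarrow> \<not> y i S \<and> \<not> y (i - 1) (w S) \<and> \<not> y (i + 1) S"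
      if "S \<in> Orb" "1 \<le> i" "i \<le> n" for S i
    proof -
      have step: "(w ^^ k) (w S) = w ((w ^^ k) S)" for k
        by (simp add: funpow_swap1)
      have si: "s i = (if b (i - 1) then s (i - 1) else Suc (s (i - 1)))"
        using s_Suc[of "i - 1"] that(2) by simp
      \<comment> \<open>If \<open>b (i - 1)\<close> fails, the extra row in \<open>s i\<close> makes
        \<open>y (i - 1) (w S)\<close> refer to the old state of i - 1; if \<open>b i\<close> fails,
        the extra row in \<open>s (Suc i)\<close> makes \<open>y (i + 1) S\<close> refer to the new
        state of i + 1.\<close>
      show ?thesis
        using b[OF closed[OF that(1), of "s i"] that(2,3)] si s_Suc[of i]
        unfolding y_def step by (auto split: if_splits)
    qed
  qed
  moreover have "(\<Sum>S\<in>Orb. chi i S :: 'k) = (\<Sum>S\<in>Orb. of_bool (y i S))" for i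
    using sum.reindex_bij_betw[OF bij[of "s i"], of "chi i :: _ \<Rightarrow> 'k"]
    by (simp add: chi_def y_def of_bool_def)
  ultimately show thesis by (rule that)
qed

theorem corollary2p31:
  fixes n :: nat and w :: "nat set \<Rightarrow> nat set"
  assumes "n \<ge> 2" and "w \<in> coxeter_elements n"
  shows "(\<forall>j. 1 \<le> j \<and> j \<le> n \<longrightarrow>
            mesic (indep_sets n) w (\<lambda>S. chi j S - chi (n + 1 - j) S) (0 :: 'k::field_char_0)) \<and>
         mesic (indep_sets n) w (\<lambda>S. 2 * chi 1 S + chi 2 S) (1 :: 'k) \<and>
         mesic (indep_sets n) w (\<lambda>S. chi (n - 1) S + 2 * chi n S) (1 :: 'k)"
proof -
  have "(\<forall>j. 1 \<le> j \<and> j \<le> n \<longrightarrow>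
      1 / of_nat (card Orb) * (\<Sum>S\<in>Orb. chi j S - chi (n + 1 - j) S) = (0 :: 'k)) \<and>
    1 / of_nat (card Orb) * (\<Sum>S\<in>Orb. 2 * chi 1 S + chi 2 S) = (1 :: 'k) \<and>
    1 / of_nat (card Orb) * (\<Sum>S\<in>Orb. chi (n - 1) S + 2 * chi n S) = (1 :: 'k)"
    if Orb: "Orb \<in> orbits_of (indep_sets n) w" for Orb
  proof -
    obtain y where "toggle_board n Orb w y"
      and chi: "\<And>i. (\<Sum>S\<in>Orb. chi i S :: 'k) = (\<Sum>S\<in>Orb. of_bool (y i S))"
      using coxeter_board[OF assms(2) Orb] by blast
    then interpret toggle_board n Orb w y by simp
    have n1: "1 \<le> n" using assms(1) by simp
    have "w \<in> Bij (indep_sets n)"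
      using assms(2) foldr_mult_toggle by (auto simp: coxeter_elements_def)
    then have "Orb \<noteq> {}" using orbits_of_bij(2) finite_indep_sets Orb by blast
    then have card: "of_nat (card Orb) \<noteq> (0 :: 'k)" using fin by simp
    have "(\<Sum>S\<in>Orb. chi j S - chi (n + 1 - j) S) = (0 :: 'k)" if "1 \<le> j" "j \<le> n" for j
    proof -
      \<comment> \<open>The reflection is an equality of cardinalities, so the indicator sums are
        turned into counts.\<close>
      have count: "(\<Sum>S\<in>Orb. of_bool (y i S) :: 'k) = of_nat (card {S \<in> Orb. y i S})" for i
        using fin by (simp add: Collect_conj_eq Int_commute)
      show ?thesis unfolding sum_subtractf chi count card_column_reflect[OF that] by (rule diff_self)
    qed
    moreover have "(\<Sum>S\<in>Orb. 2 * chi 1 S + chi 2 S) = (of_nat (card Orb) :: 'k)"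
      using sum_first[OF n1, where 'b = 'k]
      unfolding sum.distrib sum_distrib_left[symmetric] chi .
    moreover have "(\<Sum>S\<in>Orb. chi (n - 1) S + 2 * chi n S) = (of_nat (card Orb) :: 'k)"
      using sum_last[OF n1, where 'b = 'k]
      unfolding sum.distrib sum_distrib_left[symmetric] chi .
    ultimately show ?thesis using card by simp
  qed
  then show ?thesis unfolding mesic_def by blast
qed

end
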